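(* Let $R$ be a commutative Noetherian local ring with $\dim R=1$ and let $I$ be an ideal of $R$. If $\operatorname{ht} I=0$, then $\mu_R(I)<\operatorname{rk} R$.
   Context: $\dim$ is Krull dimension. The height of an ideal $I\subseteq R$ is $\operatorname{ht} I=\min\{\operatorname{ht}\mathfrak p\mid I\subseteq\mathfrak p\in\operatorname{Spec} R\}$. For an $R$-module $M$, $\mu_R(M)$ denotes the minimal number of generators of $M$ as an $R$-module, and the rank of $R$ is $\operatorname{rk} R=\sup\{\mu_R(J)\mid J\subseteq R \text{ an ideal}\}\in\{0,1,2,\ldots\}\cup\{\infty\}$. *)

theory Defs
  imports "HOL-Algebra.Algebra" "HOL-Library.Extended_Nat"
begin

definition local_ring :: "('a, 'm) ring_scheme \<Rightarrow> bool" where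
  "local_ring R \<longleftrightarrow> cring R \<and> (\<exists>!M. maximalideal M R)"

(* Strict chains p_0 < p_1 < ... < p_n of prime ideals, as nonempty lists of length n + 1. *)
definition prime_chains :: "('a, 'm) ring_scheme \<Rightarrow> 'a set list set" where
  "prime_chains R = {c. c \<noteq> [] \<and> (\<forall>p \<in> set c. primeideal p R) \<and> sorted_wrt (\<subset>) c}"

(* The zero ring, which has no prime ideals, gets dimension 0 (supremum of the empty set in enat);
   local rings are nonzero, so they are not affected by this convention. *)
definition krull_dim :: "('a, 'm) ring_scheme \<Rightarrow> enat" where
  "krull_dim R = (SUP c \<in> prime_chains R. enat (length c - 1))"

definition prime_height :: "('a, 'm) ring_scheme \<Rightarrow> 'a set \<Rightarrow> enat" where
  "prime_height R p = (SUP c \<in> {c \<in> prime_chains R. last c = p}. enat (length c - 1))"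

(* The infimum is attained for proper I, enat being well-ordered; the unit ideal has height \<infinity>. *)
definition ideal_height :: "('a, 'm) ring_scheme \<Rightarrow> 'a set \<Rightarrow> enat" where
  "ideal_height R I = (INF p \<in> {p. primeideal p R \<and> I \<subseteq> p}. prime_height R p)"

definition submodule_span ::
    "('a, 'm) ring_scheme \<Rightarrow> ('a, 'b, 'n) module_scheme \<Rightarrow> 'b set \<Rightarrow> 'b set" where
  "submodule_span R M S = \<Inter>{H. submodule H R M \<and> S \<subseteq> H}"

(* Equal to \<infinity> when M is not finitely generated. *)
definition min_gens :: "('a, 'm) ring_scheme \<Rightarrow> ('a, 'b, 'n) module_scheme \<Rightarrow> enat" where
  "min_gens R M =
    (INF S \<in> {S. finite S \<and> S \<subseteq> carrier M \<and> submodule_span R M S = carrier M}. enat (card S))"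

(* The fields mult and one are part of the module record but play no role in modules. *)
definition ideal_module :: "('a, 'm) ring_scheme \<Rightarrow> 'a set \<Rightarrow> ('a, 'a) module" where
  "ideal_module R I =
    \<lparr>carrier = I, monoid.mult = monoid.mult R, one = \<one>\<^bsub>R\<^esub>, ring.zero = \<zero>\<^bsub>R\<^esub>, add = add R,
      smult = monoid.mult R\<rparr>"

definition ring_rank :: "('a, 'm) ring_scheme \<Rightarrow> enat" where
  "ring_rank R = (SUP J \<in> {J. ideal J R}. min_gens R (ideal_module R J))"

lemma module_self:
  assumes "cring R"
  shows "module R (ideal_module R (carrier R))"
proof -
  interpret cring R by fact
  show ?thesis
  proof (rule moduleI)
    show "abelian_group (ideal_module R (carrier R))"
      by (rule abelian_groupI) (auto simp: ideal_module_def a_ac add.l_inv_ex)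
  qed (auto simp: ideal_module_def m_assoc l_distr r_distr assms)
qed

lemma submodule_self_iff_ideal:
  assumes "cring R"
  shows "submodule H R (ideal_module R (carrier R)) \<longleftrightarrow> ideal H R"
proof -
  interpret cring R by fact
  have am: "subgroup H (add_monoid (ideal_module R (carrier R))) \<longleftrightarrow> subgroup H (add_monoid R)"
    by (simp add: subgroup_def ideal_module_def m_inv_def)
  show ?thesis
  proof
    assume "submodule H R (ideal_module R (carrier R))"
    then have s: "subgroup H (add_monoid R)"
      and c: "\<And>a x. \<lbrakk>a \<in> carrier R; x \<in> H\<rbrakk> \<Longrightarrow> a \<otimes>\<^bsub>R\<^esub> x \<in> H"
      unfolding submodule_def submodule_axioms_def am by (auto simp: ideal_module_def)
    have "H \<subseteq> carrier R" using subgroup.subset[OF s] by simp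
    then show "ideal H R"
      by (intro idealI ring_axioms s) (use c m_comm in \<open>metis subsetD\<close>)+
  next
    assume "ideal H R"
    then interpret ideal H R .
    show "submodule H R (ideal_module R (carrier R))"
      unfolding submodule_def submodule_axioms_def am
      using a_subgroup I_l_closed by (auto simp: ideal_module_def)
  qed
qed

lemma ideal_module_is_module:
  assumes "cring R" "ideal I R"
  shows "module R (ideal_module R I)"
  using submodule.submodule_is_module[of I R "ideal_module R (carrier R)"]
    module_self submodule_self_iff_ideal assms
  by (auto simp: ideal_module_def)

lemma submodule_ideal_module_iff:
  assumes "cring R" "ideal I R"
  shows "submodule H R (ideal_module R I) \<longleftrightarrow> ideal H R \<and> H \<subseteq> I"
proof -
  have eq: "ideal_module R I\<lparr>carrier := K\<rparr> = ideal_module R K" for K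
    by (simp add: ideal_module_def)
  have IR: "I \<subseteq> carrier R"
    using assms(2) by (simp add: additive_subgroup.a_subset ideal.axioms(1))
  have l: "ideal H R" if "H \<subseteq> carrier R" "module R (ideal_module R H)"
    using module.module_incl_imp_submodule[OF module_self[OF assms(1)], of H] that
      submodule_self_iff_ideal[OF assms(1)] by (simp add: eq) (simp add: ideal_module_def)
  show ?thesis
  proof
    assume s: "submodule H R (ideal_module R I)"
    have "H \<subseteq> I"
      using module.submoduleE(1)[OF ideal_module_is_module[OF assms] s] by (simp add: ideal_module_def)
    moreover have "module R (ideal_module R H)"
      using submodule.submodule_is_module[OF s ideal_module_is_module[OF assms]] by (simp add: eq)
    ultimately show "ideal H R \<and> H \<subseteq> I" using l IR by blast
  next
    assume "ideal H R \<and> H \<subseteq> I"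
    then show "submodule H R (ideal_module R I)"
      using module.module_incl_imp_submodule[OF ideal_module_is_module[OF assms], of H]
        ideal_module_is_module[OF assms(1), of H] by (simp add: eq) (simp add: ideal_module_def)
  qed
qed

(* For ideals, generation as a module is generation as an ideal. *)
lemma min_gens_ideal:
  assumes "cring R" "ideal I R"
  shows "min_gens R (ideal_module R I) =
    (INF S \<in> {S. finite S \<and> S \<subseteq> carrier R \<and> genideal R S = I}. enat (card S))"
proof -
  interpret cring R by fact
  interpret I: ideal I R by fact
  have span: "submodule_span R (ideal_module R I) S = genideal R S" if "S \<subseteq> I" for S
  proof -
    have "genideal R S \<subseteq> I" using genideal_minimal[OF assms(2) that] .
    moreover have "ideal (genideal R S) R" "S \<subseteq> genideal R S"
      using that I.a_subset genideal_ideal genideal_self by auto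
    ultimately show ?thesis
      unfolding submodule_span_def submodule_ideal_module_iff[OF assms]
      using genideal_minimal by blast
  qed
  have "{S. finite S \<and> S \<subseteq> carrier (ideal_module R I) \<and>
        submodule_span R (ideal_module R I) S = carrier (ideal_module R I)} =
      {S. finite S \<and> S \<subseteq> carrier R \<and> genideal R S = I}"
    using span I.a_subset by (auto simp: ideal_module_def dest: subsetD[OF genideal_self])
  then show ?thesis by (simp add: min_gens_def)
qed

end

theory Submission
  imports Defs
begin

text \<open>
  Let \<open>\<mm>\<close> be the maximal ideal of \<open>R\<close>. It suffices to find an ideal that needs one more generator than
  \<open>I\<close>, for then \<open>\<mu>(I) + 1 \<le> rk R\<close> with \<open>\<mu>(I)\<close> finite, and so \<open>\<mu>(I) < rk R\<close>, be the rank finite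
  or not.

  An ideal of height \<open>0\<close> lies in a prime \<open>p\<close> of height \<open>0\<close>, and \<open>p \<noteq> \<mm>\<close> because \<open>\<mm>\<close> has positive
  height in a local ring of positive dimension (\<open>prime_height_maximal_pos\<close>). Choose
  \<open>z \<in> \<mm> - p\<close>. The ascending chain of the ideals \<open>(\<mm>I : z\<^sup>k)\<close> becomes stationary, say at \<open>k\<close>; put
  \<open>y = z\<^sup>k\<^sup>+\<^sup>1\<close>. If \<open>y r \<in> I\<close>, then \<open>z y r \<in> \<mm>I\<close>, hence already \<open>y r \<in> \<mm>I\<close>. So
  \<open>I \<inter> yR \<subseteq> \<mm>I\<close>, while \<open>y \<notin> I\<close> since no power of \<open>z\<close> lies in \<open>p\<close>
  (\<open>exists_element_meeting_in_maximal_multiple\<close>). This elementary argument takes the place of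
  the Artin-Rees lemma.

  The ideal \<open>J = I + yR\<close> then satisfies \<open>\<mu>(J) > \<mu>(I)\<close> (\<open>fewer_generators\<close>). Indeed \<open>y \<notin> \<mm>J\<close>, so
  in any finite generating set of \<open>J\<close> the element \<open>y\<close> can replace some generator
  (\<open>exchange_generator\<close>). The remaining generators may be changed by multiples of \<open>y\<close> so that they lie
  in \<open>I\<close>. They generate \<open>I\<close> modulo \<open>I \<inter> yR \<subseteq> \<mm>I\<close>, hence they generate \<open>I\<close> by Nakayama's
  lemma.
\<close>

section \<open>Adjoining one element to an ideal\<close>

(* The infix <+> denotes the sum of ideals, not the disjoint sum of sets. *)
no_notation Sum_Type.Plus (infixr \<open><+>\<close> 65)

lemma (in cring) mem_add_PIdl_iff:
  "x \<in> I <+> PIdl y \<longleftrightarrow> (\<exists>i\<in>I. \<exists>r\<in>carrier R. x = i \<oplus> r \<otimes> y)"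
  unfolding set_add_def' cgenideal_def by blast

lemma (in cring) add_PIdl:
  assumes "ideal I R" "y \<in> carrier R"
  shows "ideal (I <+> PIdl y) R" "I \<subseteq> I <+> PIdl y" "y \<in> I <+> PIdl y"
proof -
  interpret I: ideal I R by fact
  show "ideal (I <+> PIdl y) R"
    using add_ideals[OF assms(1) cgenideal_ideal[OF assms(2)]] .
  show "I \<subseteq> I <+> PIdl y"
  proof
    fix x assume "x \<in> I"
    then show "x \<in> I <+> PIdl y"
      unfolding mem_add_PIdl_iff using assms(2)
      by (intro bexI[of _ x] bexI[of _ \<zero>]) auto
  qed
  show "y \<in> I <+> PIdl y"
    unfolding mem_add_PIdl_iff using assms(2)
    by (intro bexI[of _ \<zero>] bexI[of _ \<one>]) auto
qed

lemma (in cring) add_PIdl_subset: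
  assumes "ideal K R" "I \<subseteq> K" "y \<in> K"
  shows "I <+> PIdl y \<subseteq> K"
proof -
  interpret K: ideal K R by fact
  show ?thesis
    using assms(2,3) by (auto simp: mem_add_PIdl_iff intro!: K.a_closed K.I_l_closed)
qed

lemma (in cring) Idl_insert:
  assumes "S \<subseteq> carrier R" "x \<in> carrier R"
  shows "Idl (insert x S) = Idl S <+> PIdl x"
proof
  have S: "ideal (Idl S) R" "S \<subseteq> Idl S"
    using assms(1) by (auto intro: genideal_ideal genideal_self[THEN subsetD])
  show "Idl (insert x S) \<subseteq> Idl S <+> PIdl x"
    using add_PIdl[OF S(1) assms(2)] S(2) by (intro genideal_minimal) auto
  show "Idl S <+> PIdl x \<subseteq> Idl (insert x S)"
    using assms genideal_self[of "insert x S"]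
    by (intro add_PIdl_subset genideal_ideal subset_Idl_subset) auto
qed

text \<open>
  This is \<open>K(L + yR) \<subseteq> KL + Ky\<close>, with the coefficient of \<open>y\<close> exhibited as an element of \<open>K\<close>: when
  \<open>K\<close> is the maximal ideal \<open>\<mm>\<close> of a local ring and \<open>w = y\<close>, the equation can be solved for \<open>y\<close>.
\<close>
lemma (in cring) ideal_prod_add_PIdl:
  assumes "ideal K R" "ideal L R" "y \<in> carrier R" "w \<in> K \<cdot> (L <+> PIdl y)"
  shows "\<exists>l\<in>K \<cdot> L. \<exists>a\<in>K. w = l \<oplus> a \<otimes> y"
proof -
  interpret K: ideal K R by fact
  interpret L: ideal L R by fact
  interpret KL: ideal "K \<cdot> L" R by (rule ideal_prod_is_ideal) fact+
  show ?thesis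
    using assms(4)
  proof (induction w rule: ideal_prod.induct)
    case (prod k j)
    then obtain l r where j: "l \<in> L" "r \<in> carrier R" "j = l \<oplus> r \<otimes> y"
      by (auto simp: mem_add_PIdl_iff)
    have "k \<in> carrier R" "l \<in> carrier R" using prod(1) j(1) by auto
    then have "k \<otimes> j = k \<otimes> l \<oplus> (k \<otimes> r) \<otimes> y"
      using j(2) assms(3) unfolding j(3) by algebra
    then show ?case
      using ideal_prod.prod[OF prod(1) j(1), of R] K.I_r_closed[OF prod(1) j(2)] by blast
  next
    case (sum s1 s2)
    then obtain l1 a1 l2 a2 where
      *: "l1 \<in> K \<cdot> L" "a1 \<in> K" "s1 = l1 \<oplus> a1 \<otimes> y"
         "l2 \<in> K \<cdot> L" "a2 \<in> K" "s2 = l2 \<oplus> a2 \<otimes> y"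
      by auto
    have "l1 \<in> carrier R" "l2 \<in> carrier R" "a1 \<in> carrier R" "a2 \<in> carrier R" using * by auto
    then have "s1 \<oplus> s2 = (l1 \<oplus> l2) \<oplus> (a1 \<oplus> a2) \<otimes> y"
      using assms(3) unfolding *(3,6) by algebra
    then show ?case using * KL.a_closed K.a_closed by blast
  qed
qed

lemma ideal_prod_mono:
  assumes "J \<subseteq> J'"
  shows "ideal_prod R I J \<subseteq> ideal_prod R I J'"
proof
  fix x assume "x \<in> ideal_prod R I J"
  then show "x \<in> ideal_prod R I J'"
    by induction (use assms in \<open>auto intro: ideal_prod.intros\<close>)
qed

section \<open>Ascending chains in Noetherian rings\<close>

lemma (in noetherian_ring) exists_maximal_ideal_in:
  assumes "F \<subseteq> {I. ideal I R}" "N \<in> F"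
  shows "\<exists>M\<in>F. \<forall>L\<in>F. M \<subseteq> L \<longrightarrow> L = M"
proof (rule subset_Zorn)
  fix C assume C: "subset.chain F C"
  show "\<exists>U\<in>F. \<forall>L\<in>C. L \<subseteq> U"
  proof (cases "C = {}")
    case True
    then show ?thesis using assms(2) by auto
  next
    case False
    have "subset.chain {I. ideal I R} C"
      using C assms(1) unfolding pred_on.chain_def by auto
    then have "\<Union>C \<in> C"
      using ideal_chain_is_trivial False by blast
    then show ?thesis
      using C unfolding pred_on.chain_def by (intro bexI[of _ "\<Union>C"]) auto
  qed
qed

lemma (in cring) ideal_colon_element:
  assumes "ideal Q R" "z \<in> carrier R"
  shows "ideal {r \<in> carrier R. z \<otimes> r \<in> Q} R"
proof -
  interpret Q: ideal Q R by fact
  show ?thesis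
  proof (rule idealI[OF ring_axioms])
    show "subgroup {r \<in> carrier R. z \<otimes> r \<in> Q} (add_monoid R)"
      using assms(2)
      by (intro subgroup.intro) (auto simp: r_distr r_minus simp flip: a_inv_def)
  next
    fix a x assume a: "a \<in> {r \<in> carrier R. z \<otimes> r \<in> Q}" and x: "x \<in> carrier R"
    then have "z \<otimes> (x \<otimes> a) = x \<otimes> (z \<otimes> a)"
      using assms(2) by (auto simp: m_lcomm)
    then show "x \<otimes> a \<in> {r \<in> carrier R. z \<otimes> r \<in> Q}"
      using a x Q.I_l_closed by auto
    then show "a \<otimes> x \<in> {r \<in> carrier R. z \<otimes> r \<in> Q}"
      using a x by (auto simp: m_comm)
  qed
qed

text \<open>
  The ideals \<open>(Q : z\<^sup>k)\<close> ascend with \<open>k\<close>, so a maximal one among them equals its successor.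
\<close>
lemma colon_powers_stabilise:
  assumes "cring R" "noetherian_ring R" "ideal Q R" "z \<in> carrier R"
  obtains k :: nat where
    "\<And>r. \<lbrakk>r \<in> carrier R; z [^]\<^bsub>R\<^esub> Suc k \<otimes>\<^bsub>R\<^esub> r \<in> Q\<rbrakk> \<Longrightarrow> z [^]\<^bsub>R\<^esub> k \<otimes>\<^bsub>R\<^esub> r \<in> Q"
proof -
  interpret cring R by fact
  interpret noetherian_ring R by fact
  interpret Q: ideal Q R by fact
  define c where "c k = {r \<in> carrier R. z [^]\<^bsub>R\<^esub> k \<otimes>\<^bsub>R\<^esub> r \<in> Q}" for k :: nat
  have "range c \<subseteq> {I. ideal I R}"
    unfolding c_def using ideal_colon_element[OF assms(3)] assms(4) by auto
  then obtain k where k: "\<forall>L\<in>range c. c k \<subseteq> L \<longrightarrow> L = c k"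
    using exists_maximal_ideal_in[of "range c" "c 0"] by blast
  have "z [^]\<^bsub>R\<^esub> Suc k \<otimes>\<^bsub>R\<^esub> r = z \<otimes>\<^bsub>R\<^esub> (z [^]\<^bsub>R\<^esub> k \<otimes>\<^bsub>R\<^esub> r)" if "r \<in> carrier R" for r
    using that assms(4) by (simp add: m_ac)
  then have "c k \<subseteq> c (Suc k)"
    unfolding c_def using Q.I_l_closed assms(4) by auto
  then have "c (Suc k) = c k" using k by blast
  then show thesis using that[of k] unfolding c_def by blast
qed

section \<open>Noetherian local rings\<close>

locale noetherian_local_ring = cring R + noetherian_ring R for R (structure) +
  fixes \<mm>
  assumes local: "local_ring R"
    and maximal: "maximalideal \<mm> R"
begin

sublocale \<mm>: maximalideal \<mm> R by (rule maximal)

lemma proper_ideal_subset: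
  assumes "ideal K R" "K \<noteq> carrier R"
  shows "K \<subseteq> \<mm>"
proof -
  let ?S = "{L. ideal L R \<and> K \<subseteq> L \<and> L \<noteq> carrier R}"
  obtain M where M: "M \<in> ?S" "\<forall>L\<in>?S. M \<subseteq> L \<longrightarrow> L = M"
    using exists_maximal_ideal_in[of ?S K] assms by auto
  have "maximalideal M R"
    by (rule maximalidealI) (use M in blast)+
  then have "M = \<mm>" using local maximal unfolding local_ring_def by blast
  then show ?thesis using M by auto
qed

lemma unit_if_not_in_maximal:
  assumes "a \<in> carrier R" "a \<notin> \<mm>"
  shows "a \<in> Units R"
proof -
  have "PIdl a = carrier R"
    using proper_ideal_subset[OF cgenideal_ideal[OF assms(1)]] cgenideal_self[OF assms(1)] assms(2)
    by blast
  then have "\<one> \<in> PIdl a" by simp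
  then show ?thesis
    using assms(1) unfolding cgenideal_def Units_def by (auto simp: m_comm)
qed

lemma one_minus_unit:
  assumes "a \<in> \<mm>"
  shows "\<one> \<ominus> a \<in> Units R"
proof (rule unit_if_not_in_maximal)
  have a: "a \<in> carrier R" using assms by auto
  then show "\<one> \<ominus> a \<in> carrier R" by simp
  show "\<one> \<ominus> a \<notin> \<mm>"
  proof
    assume "\<one> \<ominus> a \<in> \<mm>"
    then have "(\<one> \<ominus> a) \<oplus> a \<in> \<mm>" using assms by (rule \<mm>.a_closed)
    moreover have "(\<one> \<ominus> a) \<oplus> a = \<one>" using a by algebra
    ultimately show False using \<mm>.one_imp_carrier \<mm>.I_notcarr by simp
  qed
qed

lemma mem_if_unit_mult_mem:
  assumes "ideal L R" "u \<in> Units R" "g \<in> carrier R" "u \<otimes> g \<in> L"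
  shows "g \<in> L"
proof -
  interpret L: ideal L R by fact
  have "inv u \<otimes> (u \<otimes> g) \<in> L" 
    by (rule L.I_l_closed[OF assms(4) Units_inv_closed[OF assms(2)]])
  moreover have "inv u \<otimes> (u \<otimes> g) = g"
    using m_assoc[OF Units_inv_closed Units_closed, of u u g] assms(2,3) by simp
  ultimately show ?thesis by simp
qed

text \<open>
  The equation says \<open>(1 - a) g = l\<close>, and \<open>1 - a\<close> is a unit. Both Nakayama's lemma and
  the proof that \<open>y \<notin> \<mm>(I + yR)\<close> whenever \<open>y \<notin> I\<close> rest on this step.
\<close>
lemma absorb_maximal_multiple:
  assumes "ideal L R" "l \<in> L" "a \<in> \<mm>" "g \<in> carrier R" "g = l \<oplus> a \<otimes> g"
  shows "g \<in> L"
proof (rule mem_if_unit_mult_mem)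
  interpret L: ideal L R by fact
  have car: "l \<in> carrier R" "a \<in> carrier R" using assms by auto
  have "(\<one> \<ominus> a) \<otimes> g = g \<ominus> a \<otimes> g" using car assms(4) by algebra
  also have "\<dots> = (l \<oplus> a \<otimes> g) \<ominus> a \<otimes> g" using assms(5) by simp
  also have "\<dots> = l" using car assms(4) by algebra
  finally show "(\<one> \<ominus> a) \<otimes> g \<in> L" using assms(2) by simp
qed (use assms one_minus_unit in auto)

text \<open>
  Nakayama's lemma. If \<open>N \<noteq> I\<close>, take an ideal \<open>L\<close> with \<open>N \<subseteq> L \<subset> I\<close> that is maximal with this
  property. Then \<open>I = L + gR\<close> for any \<open>g \<in> I - L\<close>, so \<open>g \<in> N + \<mm>I \<subseteq> L + \<mm>g\<close>, which forces
  \<open>g \<in> L\<close>.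
\<close>
lemma nakayama:
  assumes "ideal N R" "ideal I R" "N \<subseteq> I" "I \<subseteq> N <+> \<mm> \<cdot> I"
  shows "N = I"
proof (rule ccontr)
  assume "N \<noteq> I"
  interpret I: ideal I R by fact
  let ?S = "{L. ideal L R \<and> N \<subseteq> L \<and> L \<subset> I}"
  have "?S \<subseteq> {I. ideal I R}" by auto
  moreover have "N \<in> ?S" using assms(1,3) \<open>N \<noteq> I\<close> by simp
  ultimately obtain L where L: "L \<in> ?S" "\<forall>K\<in>?S. L \<subseteq> K \<longrightarrow> K = L"
    by (rule bexE[OF exists_maximal_ideal_in])
  obtain g where g: "g \<in> I" "g \<notin> L" using L(1) by auto
  interpret L: ideal L R using L by simp
  have gR: "g \<in> carrier R" using g by auto
  note A = add_PIdl[OF L.is_ideal gR]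
  have "L <+> PIdl g \<subseteq> I"
    using add_PIdl_subset[OF assms(2)] L(1) g by auto
  then have I: "I = L <+> PIdl g"
    using A L g(2) by blast
  obtain n w where nw: "n \<in> N" "w \<in> \<mm> \<cdot> I" "g = n \<oplus> w"
    using assms(4) g(1) unfolding set_add_def' by blast
  obtain l a where la: "l \<in> \<mm> \<cdot> L" "a \<in> \<mm>" "w = l \<oplus> a \<otimes> g"
    using ideal_prod_add_PIdl[OF \<mm>.is_ideal L.is_ideal gR] nw(2) I by blast
  have nl: "n \<in> L" "l \<in> L"
    using nw(1) la(1) L(1) ideal_prod_inter[OF \<mm>.is_ideal L.is_ideal] by auto
  have "g = (n \<oplus> l) \<oplus> a \<otimes> g"
    using nw(3) la nl gR by (simp add: a_assoc)
  then show False
    using absorb_maximal_multiple[OF L.is_ideal _ la(2) gR] nl g(2) by blast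
qed

text \<open>
  If \<open>y\<close> is written in terms of the generators, some coefficient is a unit because \<open>y \<notin> \<mm> Idl S\<close>, and
  its generator can be solved for. The induction removes one generator \<open>x\<close> at a time: if the
  coefficient \<open>a\<close> of \<open>x\<close> lies in \<open>\<mm>\<close>, the remaining part \<open>w = y - a x\<close> satisfies the hypothesis for the
  smaller set.
\<close>
lemma exchange_generator:
  assumes "finite S" "S \<subseteq> carrier R" "y \<in> Idl S" "y \<notin> \<mm> \<cdot> (Idl S)"
  shows "\<exists>s\<in>S. s \<in> Idl (insert y (S - {s}))"
  using assms
proof (induction S arbitrary: y rule: finite_induct)
  case empty
  have "\<zero> \<in> \<mm> \<cdot> (Idl {})"
    using ideal_prod_is_ideal[OF \<mm>.is_ideal genideal_ideal[of "{}"]]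
    by (simp add: additive_subgroup.zero_closed ideal.axioms(1))
  moreover have "Idl {} \<subseteq> {\<zero>}"
    by (intro genideal_minimal zeroideal) simp
  ultimately show ?case using empty by auto
next
  case (insert x S)
  have S: "S \<subseteq> carrier R" and x: "x \<in> carrier R" using insert.prems by auto
  interpret IS: ideal "Idl S" R using genideal_ideal[OF S] .
  obtain w a where wa: "w \<in> Idl S" "a \<in> carrier R" "y = w \<oplus> a \<otimes> x"
    using insert.prems Idl_insert[OF S x] mem_add_PIdl_iff by blast
  have w: "w \<in> carrier R" using wa(1) by auto
  have y: "y \<in> carrier R" using wa w x by auto
  show ?case
  proof (cases "a \<in> \<mm>")
    case False
    have c: "insert y S \<subseteq> carrier R" using S y by simp
    interpret K: ideal "Idl (insert y S)" R using genideal_ideal[OF c] .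
    have "w \<in> Idl (insert y S)" "y \<in> Idl (insert y S)"
      using wa(1) subset_Idl_subset[OF c, of S] genideal_self[OF c] by auto
    then have "y \<ominus> w \<in> Idl (insert y S)"
      unfolding a_minus_def by (intro K.a_closed K.a_inv_closed)
    moreover have "y \<ominus> w = a \<otimes> x" using wa(2) w x unfolding wa(3) by algebra
    ultimately have "x \<in> Idl (insert y S)"
      using mem_if_unit_mult_mem[OF K.is_ideal unit_if_not_in_maximal[OF wa(2) False] x] by simp
    then show ?thesis using insert.hyps(2) by (intro bexI[of _ x]) auto
  next
    case True
    have "x \<in> Idl (insert x S)" using genideal_self[of "insert x S"] insert.prems by auto
    then have ax: "a \<otimes> x \<in> \<mm> \<cdot> (Idl (insert x S))"
      using ideal_prod.prod True by metis
    have "w \<notin> \<mm> \<cdot> (Idl S)"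
    proof
      assume "w \<in> \<mm> \<cdot> (Idl S)"
      then have "w \<in> \<mm> \<cdot> (Idl (insert x S))"
        using ideal_prod_mono subset_Idl_subset[of "insert x S" S] insert.prems(1) by blast
      then show False using ax insert.prems(3) wa(3) ideal_prod.sum by metis
    qed
    then obtain s where s: "s \<in> S" "s \<in> Idl (insert w (S - {s}))"
      using insert.IH[OF S wa(1)] by blast
    let ?T = "insert y (insert x S - {s})"
    have T: "?T \<subseteq> carrier R" using insert.prems y by auto
    interpret K: ideal "Idl ?T" R using genideal_ideal[OF T] .
    have "x \<in> ?T" using s(1) insert.hyps(2) by auto
    then have "y \<in> Idl ?T" "x \<in> Idl ?T" using genideal_self[OF T] by auto
    then have "y \<ominus> a \<otimes> x \<in> Idl ?T"
      unfolding a_minus_def using wa(2) by (intro K.a_closed K.a_inv_closed K.I_l_closed)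
    moreover have "y \<ominus> a \<otimes> x = w" using wa(2) w x unfolding wa(3) by algebra
    ultimately have "Idl (insert w (S - {s})) \<subseteq> Idl ?T"
      using genideal_self[OF T] by (intro genideal_minimal K.is_ideal) auto
    then show ?thesis using s by blast
  qed
qed

section \<open>An ideal with one more generator\<close>

text \<open>
  The condition \<open>I \<inter> yR \<subseteq> \<mm>I\<close> says that \<open>I/\<mm>I\<close> embeds in \<open>J/\<mm>J\<close> for \<open>J = I + yR\<close>, and \<open>y\<close>
  contributes one more dimension. The proof works with generators instead of vector spaces over
  the residue field.
\<close>
lemma fewer_generators:
  assumes "ideal I R" "y \<in> \<mm>" "y \<notin> I" "I \<inter> PIdl y \<subseteq> \<mm> \<cdot> I"
    and "finite S" "S \<subseteq> carrier R" "Idl S = I <+> PIdl y"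
  shows "\<exists>T\<subseteq>carrier R. finite T \<and> Idl T = I \<and> card T < card S"
proof -
  interpret I: ideal I R by fact
  have yR: "y \<in> carrier R" using assms(2) by auto
  note J = add_PIdl[OF assms(1) yR]
  have "y \<notin> \<mm> \<cdot> (Idl S)"
  proof
    assume "y \<in> \<mm> \<cdot> (Idl S)"
    then obtain l a where "l \<in> \<mm> \<cdot> I" "a \<in> \<mm>" "y = l \<oplus> a \<otimes> y"
      using ideal_prod_add_PIdl[OF \<mm>.is_ideal assms(1) yR] assms(7) by metis
    then show False
      using absorb_maximal_multiple[OF assms(1)] yR assms(3)
        ideal_prod_inter[OF \<mm>.is_ideal assms(1)] by blast
  qed
  then obtain s where s: "s \<in> S" "s \<in> Idl (insert y (S - {s}))"
    using exchange_generator[OF assms(5,6)] J(3) assms(7) by blast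
  \<comment> \<open>Modulo \<open>yR\<close>, each generator of \<open>I + yR\<close> agrees with an element \<open>f t\<close> of \<open>I\<close>.\<close>
  have "\<exists>i\<in>I. \<exists>r\<in>carrier R. t = i \<oplus> r \<otimes> y" if "t \<in> S" for t
    using that genideal_self[OF assms(6)] assms(7) mem_add_PIdl_iff by blast
  then obtain f g where fg: "\<And>t. t \<in> S \<Longrightarrow> f t \<in> I \<and> g t \<in> carrier R \<and> t = f t \<oplus> g t \<otimes> y"
    by metis
  define T where "T = f ` (S - {s})"
  have TI: "T \<subseteq> I" using fg unfolding T_def by auto
  then have TR: "T \<subseteq> carrier R" by auto
  have N: "ideal (Idl T) R" using genideal_ideal[OF TR] .
  have NI: "Idl T \<subseteq> I" using genideal_minimal[OF assms(1) TI] .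
  note K = add_PIdl[OF N yR]
  have sub: "S - {s} \<subseteq> Idl T <+> PIdl y"
  proof
    fix t assume t: "t \<in> S - {s}"
    then have "f t \<in> Idl T" using genideal_self[OF TR] unfolding T_def by blast
    then show "t \<in> Idl T <+> PIdl y"
      unfolding mem_add_PIdl_iff using fg[of t] t by blast
  qed
  then have "Idl (insert y (S - {s})) \<subseteq> Idl T <+> PIdl y"
    using K by (intro genideal_minimal) auto
  then have "S \<subseteq> Idl T <+> PIdl y" using s sub by blast
  then have JK: "I <+> PIdl y \<subseteq> Idl T <+> PIdl y"
    unfolding assms(7)[symmetric] using K(1) by (intro genideal_minimal)
  \<comment> \<open>An element of \<open>I\<close> is \<open>n + r y\<close> with \<open>n \<in> Idl T \<subseteq> I\<close>, hence \<open>r y \<in> I \<inter> yR\<close>.\<close>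
  have "I \<subseteq> Idl T <+> \<mm> \<cdot> I"
  proof
    fix u assume u: "u \<in> I"
    then obtain n r where n: "n \<in> Idl T" "r \<in> carrier R" "u = n \<oplus> r \<otimes> y"
      using J(2) JK unfolding mem_add_PIdl_iff[symmetric] by (meson mem_add_PIdl_iff subsetD)
    have nI: "n \<in> I" using n(1) NI by auto
    then have "u \<ominus> n \<in> I" unfolding a_minus_def using u by (intro I.a_closed I.a_inv_closed)
    moreover have "u \<ominus> n = r \<otimes> y"
      using n(2) nI I.Icarr yR unfolding n(3) by algebra
    ultimately have "r \<otimes> y \<in> I \<inter> PIdl y" using n(2) unfolding cgenideal_def by auto
    then show "u \<in> Idl T <+> \<mm> \<cdot> I"
      unfolding set_add_def' using assms(4) n by blast
  qed
  then have "Idl T = I" by (rule nakayama[OF N assms(1) NI])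
  moreover have "card T < card S"
    unfolding T_def using card_image_le[of "S - {s}" f] card_Diff1_less[OF assms(5) s(1)] assms(5)
    by (simp add: le_less_trans)
  ultimately show ?thesis using TR assms(5) unfolding T_def by blast
qed

text \<open>
  The element is a power of some \<open>z \<in> \<mm> - p\<close>, with the exponent so large that \<open>(\<mm>I : z\<^sup>k)\<close> is
  stationary: multiplying an element of \<open>I \<inter> yR\<close> by \<open>z\<close> moves it into \<open>\<mm>I\<close>, and stationarity allows
  \<open>z\<close> to be cancelled again.
\<close>
lemma exists_element_meeting_in_maximal_multiple:
  assumes "ideal I R" "primeideal p R" "I \<subseteq> p" "p \<noteq> \<mm>"
  shows "\<exists>y\<in>\<mm>. y \<notin> I \<and> I \<inter> PIdl y \<subseteq> \<mm> \<cdot> I"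
proof -
  interpret p: primeideal p R by fact
  interpret I: ideal I R by fact
  have mI: "ideal (\<mm> \<cdot> I) R" using ideal_prod_is_ideal[OF \<mm>.is_ideal assms(1)] .
  have "p \<subseteq> \<mm>" using proper_ideal_subset[OF p.is_ideal] p.I_notcarr by blast
  then obtain z where z: "z \<in> \<mm>" "z \<notin> p" using assms(4) by blast
  have zR: "z \<in> carrier R" using z by auto
  obtain k :: nat where
    k: "\<And>r. \<lbrakk>r \<in> carrier R; z [^] Suc k \<otimes> r \<in> \<mm> \<cdot> I\<rbrakk> \<Longrightarrow> z [^] k \<otimes> r \<in> \<mm> \<cdot> I"
    using colon_powers_stabilise[OF is_cring noetherian_ring_axioms mI zR] by blast
  have pow: "z [^] n \<notin> p" for n :: nat
  proof (induction n)
    case 0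
    show ?case using p.one_imp_carrier p.I_notcarr by auto
  next
    case (Suc n)
    then show ?case using p.I_prime[of "z [^] n" z] z(2) zR by auto
  qed
  \<comment> \<open>The exponent is \<open>k + 1\<close> rather than \<open>k\<close> so that \<open>y \<in> \<mm>\<close> also when \<open>k = 0\<close>.\<close>
  define y where "y = z [^] Suc k"
  have yR: "y \<in> carrier R" using zR unfolding y_def by simp
  show ?thesis
  proof (intro bexI[of _ y] conjI)
    show "y \<in> \<mm>" unfolding y_def using z zR \<mm>.I_l_closed by simp
    show "y \<notin> I" using pow[of "Suc k"] assms(3) unfolding y_def by blast
    show "I \<inter> PIdl y \<subseteq> \<mm> \<cdot> I"
    proof
      fix u assume u: "u \<in> I \<inter> PIdl y"
      then obtain r where r: "r \<in> carrier R" "u = r \<otimes> y" unfolding cgenideal_def by blast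
      have "z \<otimes> u \<in> \<mm> \<cdot> I" using ideal_prod.prod z u by (metis IntD1)
      moreover have "z \<otimes> u = z [^] Suc k \<otimes> (z \<otimes> r)"
        using r zR unfolding y_def by (simp add: m_ac)
      ultimately have "z [^] k \<otimes> (z \<otimes> r) \<in> \<mm> \<cdot> I"
        using k[of "z \<otimes> r"] r zR by simp
      moreover have "z [^] k \<otimes> (z \<otimes> r) = u"
        using r zR unfolding y_def by (simp add: m_ac)
      ultimately show "u \<in> \<mm> \<cdot> I" by simp
    qed
  qed
qed

text \<open>
  In a local ring of any dimension, the ideals covered are those that are neither \<open>\<mm>\<close>-primary nor the
  unit ideal.
\<close>
lemma min_gens_less_rank:
  assumes "ideal I R" "primeideal p R" "I \<subseteq> p" "p \<noteq> \<mm>"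
  shows "min_gens R (ideal_module R I) < ring_rank R"
proof -
  obtain y where y: "y \<in> \<mm>" "y \<notin> I" "I \<inter> PIdl y \<subseteq> \<mm> \<cdot> I"
    using exists_element_meeting_in_maximal_multiple[OF assms] by blast
  let ?\<mu> = "\<lambda>K. min_gens R (ideal_module R K)"
  let ?J = "I <+> PIdl y"
  have J: "ideal ?J R" using add_PIdl(1)[OF assms(1)] y(1) by auto
  note \<mu> = min_gens_ideal[OF is_cring]
  have \<mu>_le: "?\<mu> I \<le> enat (card T)" if "finite T" "T \<subseteq> carrier R" "Idl T = I" for T
    unfolding \<mu>[OF assms(1)] using that by (intro INF_lower) auto
  obtain A where "A \<subseteq> carrier R" "finite A" "I = Idl A"
    using finetely_gen[OF assms(1)] by blast
  then have "?\<mu> I < \<infinity>"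
    by (intro le_less_trans[OF \<mu>_le[of A]]) auto
  moreover have "eSuc (?\<mu> I) \<le> ?\<mu> ?J"
    unfolding \<mu>[OF J]
  proof (rule INF_greatest)
    fix S assume "S \<in> {S. finite S \<and> S \<subseteq> carrier R \<and> Idl S = ?J}"
    then obtain T where T: "T \<subseteq> carrier R" "finite T" "Idl T = I" "card T < card S"
      using fewer_generators[OF assms(1) y] by blast
    then have "?\<mu> I < enat (card S)"
      using \<mu>_le[of T] by (meson enat_ord_simps(2) le_less_trans)
    then show "eSuc (?\<mu> I) \<le> enat (card S)" by (rule ileI1)
  qed
  moreover have "?\<mu> ?J \<le> ring_rank R"
    unfolding ring_rank_def using J by (intro SUP_upper) auto
  ultimately show ?thesis
    by (cases "?\<mu> I") (auto simp: eSuc_enat Suc_ile_eq intro: less_le_trans)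
qed

section \<open>Ideals of height zero\<close>

text \<open>
  A chain of primes of positive length starts with a prime strictly below another one, hence strictly
  below \<open>\<mm>\<close>.
\<close>
lemma prime_height_maximal_pos:
  assumes "krull_dim R > 0"
  shows "prime_height R \<mm> > 0"
proof -
  obtain c where c: "c \<in> prime_chains R" "0 < enat (length c - 1)"
    using assms unfolding krull_dim_def less_SUP_iff by blast
  then obtain p q c' where pq: "c = p # q # c'"
    by (cases c rule: remdups_adj.cases) (auto simp: zero_enat_def)
  have p: "primeideal p R" and q: "primeideal q R" and "p \<subset> q"
    using c unfolding pq prime_chains_def by auto
  interpret q: primeideal q R by fact
  have "q \<subseteq> \<mm>" using proper_ideal_subset[OF q.is_ideal] q.I_notcarr by blast
  then have "p \<subset> \<mm>" using \<open>p \<subset> q\<close> by blast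
  then have "[p, \<mm>] \<in> {c \<in> prime_chains R. last c = \<mm>}"
    unfolding prime_chains_def using p maximalideal_prime[OF maximal] by auto
  then have "enat (length [p, \<mm>] - 1) \<le> prime_height R \<mm>"
    unfolding prime_height_def by (rule SUP_upper)
  then show ?thesis by (simp add: Suc_ile_eq flip: zero_enat_def)
qed

end

theorem lemma2p1:
  fixes R :: "('a, 'm) ring_scheme" and I :: "'a set"
  assumes "cring R"
    and "noetherian_ring R"
    and "local_ring R"
    and "krull_dim R = 1"
    and "ideal I R"
    and "ideal_height R I = 0"
  shows "min_gens R (ideal_module R I) < ring_rank R"
proof -
  obtain m where m: "maximalideal m R"
    using assms(3) unfolding local_ring_def by blast
  interpret noetherian_local_ring R m
    using assms(1-3) m by (simp add: noetherian_local_ring_def noetherian_local_ring_axioms_def)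
  have "ideal_height R I < 1" using assms(6) by simp
  then obtain p where p: "primeideal p R" "I \<subseteq> p" "prime_height R p < 1"
    unfolding ideal_height_def INF_less_iff by blast
  have "p \<noteq> m"
    using p(3) prime_height_maximal_pos assms(4) by (auto simp: ileI1 one_eSuc)
  then show ?thesis using min_gens_less_rank assms(5) p by blast
qed

end
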